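(* Let $\Omega\subset\mathbb R^N$ be a bounded Lipschitz domain, $s\in(0,1)$, $\alpha>0$, and let $K:H_0^s(\Omega)\to L^2(\Omega)$ be bounded and linear. For $y\in L^2(\Omega)$ let $S_\alpha(y)\in H_0^s(\Omega)$ denote the unique minimizer over $u\in H_0^s(\Omega)$ of $\frac12\|Ku-y\|_{L^2(\Omega)}^2+\frac{\alpha}{2}\|u\|_{H_0^s(\Omega)}^2$. Then there exists a constant $C>0$, depending only on $\alpha$ and on the operator norm $\|K\|$ of $K:H_0^s(\Omega)\to L^2(\Omega)$, such that for all $y_1^\delta,y_2^\delta\in L^2(\Omega)$, with $u_1=S_\alpha(y_1^\delta)$ and $u_2=S_\alpha(y_2^\delta)$, $$\|u_1-u_2\|_{H_0^s(\Omega)}\le C\,\|y_1^\delta-y_2^\delta\|_{L^2(\Omega)}.$$ Hence the solution operator $S_\alpha:L^2(\Omega)\to H_0^s(\Omega)$ is Lipschitz continuous.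
   Context: All spaces are real. $H_0^s(\Omega)$ is the space of functions $u\in H^s(\mathbb R^N)$ with $u=0$ a.e. in $\mathbb R^N\setminus\Omega$ (also regarded as functions on $\Omega$). It is a Hilbert space with norm $$\|u\|_{H_0^s(\Omega)}^2=\|u\|_{L^2(\Omega)}^2+\frac{C_{N,s}}{2}\iint_{\mathbb R^{2N}}\frac{|u(x)-u(y)|^2}{|x-y|^{N+2s}}\,dx\,dy,$$ where $C_{N,s}>0$ is the standard normalization constant of the integral fractional Laplacian, $C_{N,s}=\frac{4^s s\,\Gamma(N/2+s)}{\pi^{N/2}\Gamma(1-s)}$. For each $y\in L^2(\Omega)$ the minimizer $S_\alpha(y)$ exists and is unique. *)

theory Defs
  imports "HOL-Analysis.Analysis"
begin

text \<open>
  The constant in the main estimate must not depend on the dimension \<open>N\<close>, so \<open>N\<close> has to be a bound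
  variable of the statement. Points of \<open>\<real>\<^sup>N\<close> are therefore extensional functions on \<open>{..<N}\<close>, the
  common carrier of the product topology and of the product measure below.

  Elements of \<open>L\<^sup>2(\<Omega>)\<close> and \<open>H\<^sub>0\<^sup>s(\<Omega>)\<close> are represented by (Borel) functions and not by classes modulo
  almost everywhere equality; all norms depend on the class only, and identities between
  elements are required almost everywhere.
\<close>

type_synonym point = "nat \<Rightarrow> real"

definition eucl_top :: "nat \<Rightarrow> point topology" where
  "eucl_top N = product_topology (\<lambda>_. euclideanreal) {..<N}"

definition eucl_measure :: "nat \<Rightarrow> point measure" where
  "eucl_measure N = Pi\<^sub>M {..<N} (\<lambda>_. lborel)"

definition eucl_norm :: "nat \<Rightarrow> point \<Rightarrow> real" where
  "eucl_norm N x = L2_set x {..<N}"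

definition eucl_dist :: "nat \<Rightarrow> point \<Rightarrow> point \<Rightarrow> real" where
  "eucl_dist N x y = eucl_norm N (\<lambda>i. x i - y i)"

definition eucl_inner :: "nat \<Rightarrow> point \<Rightarrow> point \<Rightarrow> real" where
  "eucl_inner N x y = (\<Sum>i<N. x i * y i)"

text \<open>Orthogonal projection onto the hyperplane \<open>e\<^sup>\<bottom>\<close>, for a unit vector \<open>e\<close>.\<close>

definition hyperplane_proj :: "nat \<Rightarrow> point \<Rightarrow> point \<Rightarrow> point" where
  "hyperplane_proj N e x = (\<lambda>i\<in>{..<N}. x i - eucl_inner N x e * e i)"

text \<open>
  Near each boundary point \<open>p\<close> the set is the strict epigraph, in some direction \<open>e\<close>, of a Lipschitz
  function \<open>g\<close> on the hyperplane \<open>e\<^sup>\<bottom>\<close>. The unit vector \<open>e\<close> plays the role of the last coordinate axis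
  after a rigid motion, and \<open>hyperplane_proj N e x\<close> that of the remaining \<open>N - 1\<close> coordinates.
\<close>

definition lipschitz_boundary :: "nat \<Rightarrow> point set \<Rightarrow> bool" where
  "lipschitz_boundary N \<Omega> \<longleftrightarrow>
     (\<forall>p \<in> (eucl_top N) frontier_of \<Omega>.
        \<exists>r > 0. \<exists>e \<in> topspace (eucl_top N). \<exists>g :: point \<Rightarrow> real. \<exists>L \<ge> 0.
          eucl_norm N e = 1 \<and>
          (\<forall>z \<in> topspace (eucl_top N). \<forall>w \<in> topspace (eucl_top N).
             eucl_inner N z e = 0 \<longrightarrow> eucl_inner N w e = 0 \<longrightarrow>
             \<bar>g z - g w\<bar> \<le> L * eucl_dist N z w) \<and>
          (\<forall>x \<in> topspace (eucl_top N). eucl_dist N x p < r \<longrightarrow>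
             (x \<in> \<Omega> \<longleftrightarrow> g (hyperplane_proj N e x) < eucl_inner N x e)))"

definition bounded_lipschitz_domain :: "nat \<Rightarrow> point set \<Rightarrow> bool" where
  "bounded_lipschitz_domain N \<Omega> \<longleftrightarrow>
     openin (eucl_top N) \<Omega> \<and> connectedin (eucl_top N) \<Omega> \<and> \<Omega> \<noteq> {} \<and>
     (\<exists>R. \<forall>x \<in> \<Omega>. eucl_norm N x \<le> R) \<and>
     lipschitz_boundary N \<Omega>"

definition L2_space :: "'a measure \<Rightarrow> ('a \<Rightarrow> real) set" where
  "L2_space M = {f \<in> borel_measurable M. integrable M (\<lambda>x. (f x)\<^sup>2)}"

definition L2_norm :: "'a measure \<Rightarrow> ('a \<Rightarrow> real) \<Rightarrow> real" where
  "L2_norm M f = sqrt (\<integral>x. (f x)\<^sup>2 \<partial>M)"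

definition meas_on :: "nat \<Rightarrow> point set \<Rightarrow> point measure" where
  "meas_on N \<Omega> = restrict_space (eucl_measure N) \<Omega>"

definition frac_const :: "nat \<Rightarrow> real \<Rightarrow> real" where
  "frac_const N s =
     4 powr s * s * Gamma (real N / 2 + s) / (pi powr (real N / 2) * Gamma (1 - s))"

text \<open>On the diagonal \<open>x = y\<close>, a null set for \<open>N \<ge> 1\<close>, the integrand is \<open>0 / 0 = 0\<close>.\<close>

definition gagliardo_integrand ::
    "nat \<Rightarrow> real \<Rightarrow> (point \<Rightarrow> real) \<Rightarrow> point \<times> point \<Rightarrow> real" where
  "gagliardo_integrand N s u =
     (\<lambda>(x, y). (u x - u y)\<^sup>2 / eucl_dist N x y powr (real N + 2 * s))"

definition Hs_space :: "nat \<Rightarrow> real \<Rightarrow> (point \<Rightarrow> real) set" where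
  "Hs_space N s =
     {u \<in> L2_space (eucl_measure N).
        integrable (eucl_measure N \<Otimes>\<^sub>M eucl_measure N) (gagliardo_integrand N s u)}"

definition H0s_space :: "nat \<Rightarrow> real \<Rightarrow> point set \<Rightarrow> (point \<Rightarrow> real) set" where
  "H0s_space N s \<Omega> =
     {u \<in> Hs_space N s. AE x in eucl_measure N. x \<notin> \<Omega> \<longrightarrow> u x = 0}"

definition H0s_norm :: "nat \<Rightarrow> real \<Rightarrow> point set \<Rightarrow> (point \<Rightarrow> real) \<Rightarrow> real" where
  "H0s_norm N s \<Omega> u =
     sqrt ((L2_norm (meas_on N \<Omega>) u)\<^sup>2 +
           frac_const N s / 2 *
             (\<integral>z. gagliardo_integrand N s u z \<partial>(eucl_measure N \<Otimes>\<^sub>M eucl_measure N)))"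

text \<open>
  Compatibility of \<open>K\<close> with almost everywhere equality needs no separate clause: if \<open>u = v\<close> almost
  everywhere then \<open>u - v\<close> has norm \<open>0\<close>, so \<open>K (u - v) = 0\<close> almost everywhere by boundedness, and
  \<open>K u = K v\<close> almost everywhere by linearity.
\<close>

definition bounded_linear_H0s_L2 ::
    "nat \<Rightarrow> real \<Rightarrow> point set \<Rightarrow> ((point \<Rightarrow> real) \<Rightarrow> (point \<Rightarrow> real)) \<Rightarrow> bool" where
  "bounded_linear_H0s_L2 N s \<Omega> K \<longleftrightarrow>
     (\<forall>u \<in> H0s_space N s \<Omega>. K u \<in> L2_space (meas_on N \<Omega>)) \<and>
     (\<forall>u \<in> H0s_space N s \<Omega>. \<forall>v \<in> H0s_space N s \<Omega>.
        AE x in meas_on N \<Omega>. K (\<lambda>t. u t + v t) x = K u x + K v x) \<and>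
     (\<forall>c. \<forall>u \<in> H0s_space N s \<Omega>. AE x in meas_on N \<Omega>. K (\<lambda>t. c * u t) x = c * K u x) \<and>
     (\<exists>B. \<forall>u \<in> H0s_space N s \<Omega>. L2_norm (meas_on N \<Omega>) (K u) \<le> B * H0s_norm N s \<Omega> u)"

text \<open>As for \<^const>\<open>onorm\<close>, the quotient is \<open>0 / 0 = 0\<close> at elements of norm \<open>0\<close>.\<close>

definition op_norm_H0s_L2 ::
    "nat \<Rightarrow> real \<Rightarrow> point set \<Rightarrow> ((point \<Rightarrow> real) \<Rightarrow> (point \<Rightarrow> real)) \<Rightarrow> real" where
  "op_norm_H0s_L2 N s \<Omega> K =
     (SUP u \<in> H0s_space N s \<Omega>. L2_norm (meas_on N \<Omega>) (K u) / H0s_norm N s \<Omega> u)"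

definition tikhonov ::
    "nat \<Rightarrow> real \<Rightarrow> point set \<Rightarrow> ((point \<Rightarrow> real) \<Rightarrow> (point \<Rightarrow> real)) \<Rightarrow> real \<Rightarrow>
     (point \<Rightarrow> real) \<Rightarrow> (point \<Rightarrow> real) \<Rightarrow> real" where
  "tikhonov N s \<Omega> K \<alpha> y u =
     1 / 2 * (L2_norm (meas_on N \<Omega>) (\<lambda>x. K u x - y x))\<^sup>2 + \<alpha> / 2 * (H0s_norm N s \<Omega> u)\<^sup>2"

definition is_minimizer ::
    "nat \<Rightarrow> real \<Rightarrow> point set \<Rightarrow> ((point \<Rightarrow> real) \<Rightarrow> (point \<Rightarrow> real)) \<Rightarrow> real \<Rightarrow>
     (point \<Rightarrow> real) \<Rightarrow> (point \<Rightarrow> real) \<Rightarrow> bool" where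
  "is_minimizer N s \<Omega> K \<alpha> y u \<longleftrightarrow>
     is_arg_min (tikhonov N s \<Omega> K \<alpha> y) (\<lambda>v. v \<in> H0s_space N s \<Omega>) u"

text \<open>
  The minimizer is unique only as a class; \<open>solution_op\<close> picks one representative. The predicate
  \<^const>\<open>is_minimizer\<close> characterizes all of them.
\<close>

definition solution_op ::
    "nat \<Rightarrow> real \<Rightarrow> point set \<Rightarrow> ((point \<Rightarrow> real) \<Rightarrow> (point \<Rightarrow> real)) \<Rightarrow> real \<Rightarrow>
     (point \<Rightarrow> real) \<Rightarrow> (point \<Rightarrow> real)" where
  "solution_op N s \<Omega> K \<alpha> y =
     arg_min (tikhonov N s \<Omega> K \<alpha> y) (\<lambda>v. v \<in> H0s_space N s \<Omega>)"

end

theory Submission imports Defs begin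

text \<open>
  Write \<open>J\<close> for the functional with data \<open>y\<close> and \<open>E w = \<parallel>K w\<parallel>\<^sup>2 + \<alpha> \<parallel>w\<parallel>\<^sup>2\<close>. The parallelogram identity gives
  \<open>J u + J v = 2 J ((u + v)/2) + E (u - v)/4\<close>. Applied to a minimizing sequence, it shows that the
  sequence is Cauchy, so that completeness of \<open>H\<^sub>0\<^sup>s(\<Omega>)\<close> yields a minimizer; applied to a minimizer \<open>u\<close>,
  it gives \<open>E (u - v)/4 \<le> J v - J u\<close>, and the sum of two such bounds is the Lipschitz estimate.
  For completeness, a Cauchy sequence has an almost everywhere convergent subsequence because \<open>\<Omega>\<close> has
  finite measure, and Fatou's lemma controls both parts of the norm of the limit.
\<close>

section \<open>Square integrable functions\<close>

lemma L2_norm_nonneg: "0 \<le> L2_norm M f"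
  by (simp add: L2_norm_def)

lemma L2_norm_sq: "(L2_norm M f)\<^sup>2 = (\<integral>x. (f x)\<^sup>2 \<partial>M)"
  by (simp add: L2_norm_def)

lemma L2_norm_cong_AE:
  assumes "f \<in> L2_space M" "g \<in> L2_space M" "AE x in M. f x = g x"
  shows "L2_norm M f = L2_norm M g"
proof -
  have [measurable]: "f \<in> borel_measurable M" "g \<in> borel_measurable M"
    using assms(1,2) by (auto simp: L2_space_def)
  have "(\<integral>x. (f x)\<^sup>2 \<partial>M) = (\<integral>x. (g x)\<^sup>2 \<partial>M)"
    using assms(3) by (intro integral_cong_AE) auto
  then show ?thesis
    by (simp add: L2_norm_def)
qed

lemma L2_space_cmult:
  assumes "f \<in> L2_space M"
  shows "(\<lambda>x. c * f x) \<in> L2_space M"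
  using assms by (auto simp: L2_space_def power_mult_distrib)

lemma L2_space_add:
  assumes "f \<in> L2_space M" "g \<in> L2_space M"
  shows "(\<lambda>x. f x + g x) \<in> L2_space M"
proof -
  have [measurable]: "f \<in> borel_measurable M" "g \<in> borel_measurable M"
    and int: "integrable M (\<lambda>x. (f x)\<^sup>2)" "integrable M (\<lambda>x. (g x)\<^sup>2)"
    using assms by (auto simp: L2_space_def)
  have bound: "(f x + g x)\<^sup>2 \<le> 2 * (f x)\<^sup>2 + 2 * (g x)\<^sup>2" for x
    using sum_squares_bound[of "f x" "g x"] by (simp add: power2_sum)
  have "integrable M (\<lambda>x. (f x + g x)\<^sup>2)"
    by (rule Bochner_Integration.integrable_bound[of _ "\<lambda>x. 2 * (f x)\<^sup>2 + 2 * (g x)\<^sup>2"])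
      (use int bound in auto)
  then show ?thesis
    by (simp add: L2_space_def)
qed

lemma L2_space_diff:
  assumes "f \<in> L2_space M" "g \<in> L2_space M"
  shows "(\<lambda>x. f x - g x) \<in> L2_space M"
  using L2_space_add[OF assms(1) L2_space_cmult[OF assms(2), of "-1"]] by simp

lemma L2_norm_cmult_sq: "(L2_norm M (\<lambda>x. c * f x))\<^sup>2 = c\<^sup>2 * (L2_norm M f)\<^sup>2"
  by (simp add: L2_norm_sq power_mult_distrib)

lemma L2_integrable_sq: "f \<in> L2_space M \<Longrightarrow> integrable M (\<lambda>x. (f x)\<^sup>2)"
  by (simp add: L2_space_def)

text \<open>The parallelogram law, written with the midpoint because the midpoint of two admissible
  functions is the competitor in the minimization.\<close>

lemma L2_norm_midpoint:
  assumes "f \<in> L2_space M" "g \<in> L2_space M"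
  shows "(L2_norm M f)\<^sup>2 + (L2_norm M g)\<^sup>2 =
    2 * (L2_norm M (\<lambda>x. 1/2 * (f x + g x)))\<^sup>2 + 1/2 * (L2_norm M (\<lambda>x. f x - g x))\<^sup>2"
proof -
  have *: "(f x)\<^sup>2 + (g x)\<^sup>2 = 2 * (1/2 * (f x + g x))\<^sup>2 + 1/2 * (f x - g x)\<^sup>2" for x
    by (simp add: power2_eq_square field_simps)
  note int = L2_integrable_sq[OF assms(1)] L2_integrable_sq[OF assms(2)]
    L2_integrable_sq[OF L2_space_cmult[OF L2_space_add[OF assms], of "1/2"]]
    L2_integrable_sq[OF L2_space_diff[OF assms]]
  have "(\<integral>x. (f x)\<^sup>2 + (g x)\<^sup>2 \<partial>M)
      = (\<integral>x. 2 * (1/2 * (f x + g x))\<^sup>2 + 1/2 * (f x - g x)\<^sup>2 \<partial>M)"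
    by (simp only: *)
  also have "\<dots> = 2 * (\<integral>x. (1/2 * (f x + g x))\<^sup>2 \<partial>M) + 1/2 * (\<integral>x. (f x - g x)\<^sup>2 \<partial>M)"
    using int by (subst Bochner_Integration.integral_add) auto
  finally show ?thesis
    using int by (simp add: L2_norm_sq)
qed

text \<open>Pointwise, the right side minus the left is the square
  \<open>(\<eta> * f x - g x)\<^sup>2 / \<eta>\<close>. This replaces the triangle inequality for
  squared norms; the factor of \<open>f\<close> can be made as close to 1 as desired.\<close>

lemma L2_norm_add_Young:
  assumes "f \<in> L2_space M" "g \<in> L2_space M" "0 < \<eta>"
  shows "(L2_norm M (\<lambda>x. f x + g x))\<^sup>2 \<le> (1 + \<eta>) * (L2_norm M f)\<^sup>2 + (1 + 1/\<eta>) * (L2_norm M g)\<^sup>2"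
proof -
  have *: "(f x + g x)\<^sup>2 \<le> (1 + \<eta>) * (f x)\<^sup>2 + (1 + 1/\<eta>) * (g x)\<^sup>2" for x
  proof -
    have "0 \<le> (\<eta> * f x - g x)\<^sup>2 / \<eta>"
      using \<open>0 < \<eta>\<close> by simp
    also have "\<dots> = (1 + \<eta>) * (f x)\<^sup>2 + (1 + 1/\<eta>) * (g x)\<^sup>2 - (f x + g x)\<^sup>2"
      using \<open>0 < \<eta>\<close> by (simp add: power2_eq_square field_simps)
    finally show ?thesis by simp
  qed
  note int = L2_integrable_sq[OF assms(1)] L2_integrable_sq[OF assms(2)]
    L2_integrable_sq[OF L2_space_add[OF assms(1,2)]]
  have "(\<integral>x. (f x + g x)\<^sup>2 \<partial>M) \<le> (\<integral>x. (1 + \<eta>) * (f x)\<^sup>2 + (1 + 1/\<eta>) * (g x)\<^sup>2 \<partial>M)"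
    using int by (intro integral_mono *) auto
  then show ?thesis
    using int by (simp add: L2_norm_sq)
qed

text \<open>Fatou's lemma for the squares: a uniform norm bound survives an almost everywhere limit,
  and with it square integrability, without norm convergence.\<close>

lemma L2_space_Fatou:
  assumes f: "\<And>n. f n \<in> L2_space M"
    and bound: "\<And>n. (L2_norm M (f n))\<^sup>2 \<le> B"
    and lim: "AE x in M. (\<lambda>n. f n x) \<longlonglongrightarrow> g x"
    and [measurable]: "g \<in> borel_measurable M"
  shows "g \<in> L2_space M" "(L2_norm M g)\<^sup>2 \<le> B"
proof -
  have [measurable]: "f n \<in> borel_measurable M" for n
    using f by (auto simp: L2_space_def)
  have "0 \<le> B"
    using bound[of 0] by (meson order_trans zero_le_power2)
  have "(\<integral>\<^sup>+x. ennreal ((g x)\<^sup>2) \<partial>M) = (\<integral>\<^sup>+x. liminf (\<lambda>n. ennreal ((f n x)\<^sup>2)) \<partial>M)"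
  proof (rule nn_integral_cong_AE)
    show "AE x in M. ennreal ((g x)\<^sup>2) = liminf (\<lambda>n. ennreal ((f n x)\<^sup>2))"
      using lim
    proof eventually_elim
      case (elim x)
      then have "(\<lambda>n. ennreal ((f n x)\<^sup>2)) \<longlonglongrightarrow> ennreal ((g x)\<^sup>2)"
        by (intro tendsto_ennrealI tendsto_power)
      then show ?case
        by (metis lim_imp_Liminf sequentially_bot)
    qed
  qed
  also have "\<dots> \<le> liminf (\<lambda>n. \<integral>\<^sup>+x. ennreal ((f n x)\<^sup>2) \<partial>M)"
    by (rule nn_integral_liminf) simp
  also have "\<dots> \<le> liminf (\<lambda>n. ennreal B)"
  proof (intro Liminf_mono always_eventually allI)
    fix n
    have "(\<integral>\<^sup>+x. ennreal ((f n x)\<^sup>2) \<partial>M) = ennreal (\<integral>x. (f n x)\<^sup>2 \<partial>M)"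
      by (intro nn_integral_eq_integral L2_integrable_sq f) simp
    also have "\<dots> \<le> ennreal B"
      using bound[of n] by (intro ennreal_leI) (simp add: L2_norm_sq)
    finally show "(\<integral>\<^sup>+x. ennreal ((f n x)\<^sup>2) \<partial>M) \<le> ennreal B" .
  qed
  also have "\<dots> = ennreal B"
    by (simp add: Liminf_const)
  finally have le: "(\<integral>\<^sup>+x. ennreal ((g x)\<^sup>2) \<partial>M) \<le> ennreal B" .
  then have "integrable M (\<lambda>x. (g x)\<^sup>2)"
    by (intro integrableI_nonneg) (auto simp: le_less_trans)
  then show "g \<in> L2_space M"
    by (simp add: L2_space_def)
  show "(L2_norm M g)\<^sup>2 \<le> B"
    unfolding L2_norm_sq using \<open>0 \<le> B\<close> le by (rule integral_real_bounded)
qed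

text \<open>On a finite measure space the L2 norm controls the L1 norm, so the sequence is Cauchy in
  L1, where an almost everywhere Cauchy subsequence can be extracted.\<close>

lemma L2_Cauchy_AE_Cauchy_subseq:
  fixes f :: "nat \<Rightarrow> 'a \<Rightarrow> real"
  assumes fin: "finite_measure M"
    and f: "\<And>n. f n \<in> L2_space M"
    and Cauchy: "\<And>e. 0 < e \<Longrightarrow> \<exists>n0. \<forall>i\<ge>n0. \<forall>j\<ge>n0. (L2_norm M (\<lambda>x. f i x - f j x))\<^sup>2 < e"
  obtains r where "strict_mono r" "AE x in M. Cauchy (\<lambda>i. f (r i) x)"
proof -
  interpret finite_measure M by fact
  define m where "m = measure M (space M)"
  have "0 \<le> m" by (simp add: m_def)
  \<comment> \<open>Pointwise substitute for Cauchy-Schwarz: the constant is integrable since the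
    measure is finite, the square is controlled by the L2 norm.\<close>
  have amgm: "\<bar>w\<bar> \<le> 1/2 * \<epsilon> + 1/(2*\<epsilon>) * w\<^sup>2" if "0 < \<epsilon>" for w \<epsilon> :: real
  proof -
    have "0 \<le> (\<bar>w\<bar> - \<epsilon>)\<^sup>2 / (2 * \<epsilon>)" using that by simp
    also have "\<dots> = 1/2 * \<epsilon> + 1/(2*\<epsilon>) * w\<^sup>2 - \<bar>w\<bar>"
      using that by (simp add: power2_diff field_simps) (simp add: power2_eq_square)
    finally show ?thesis by simp
  qed
  have int1: "integrable M w" if "w \<in> L2_space M" for w :: "'a \<Rightarrow> real"
  proof (rule Bochner_Integration.integrable_bound)
    show "integrable M (\<lambda>x. 1/2 * 1 + 1/(2*1) * (w x)\<^sup>2)"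
      using L2_integrable_sq[OF that] by simp
    show "AE x in M. norm (w x) \<le> norm (1/2 * 1 + 1/(2*1) * (w x)\<^sup>2)"
      using amgm[of 1] by simp
  qed (use that in \<open>simp add: L2_space_def\<close>)
  have "\<exists>n0. \<forall>i\<ge>n0. \<forall>j\<ge>n0. (LINT x|M. norm (f i x - f j x)) < e" if "0 < e" for e
  proof -
    \<comment> \<open>With this choice and the threshold \<open>\<epsilon> * e\<close>, the two
      terms of \<open>amgm\<close> integrate to at most \<open>e / 2\<close> and to less than
      \<open>e / 2\<close>. The summand 1 covers total mass 0.\<close>
    define \<epsilon> where "\<epsilon> = e / (m + 1)"
    have "0 < \<epsilon>" using that \<open>0 \<le> m\<close> by (simp add: \<epsilon>_def)
    obtain n0 where n0: "\<And>i j. i \<ge> n0 \<Longrightarrow> j \<ge> n0 \<Longrightarrow> (L2_norm M (\<lambda>x. f i x - f j x))\<^sup>2 < \<epsilon> * e"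
      using Cauchy[of "\<epsilon> * e"] \<open>0 < \<epsilon>\<close> \<open>0 < e\<close> by auto
    have "(LINT x|M. norm (f i x - f j x)) < e" if "i \<ge> n0" "j \<ge> n0" for i j
    proof -
      define w where "w = (\<lambda>x. f i x - f j x)"
      have w: "w \<in> L2_space M"
        unfolding w_def by (intro L2_space_diff f)
      have "(LINT x|M. norm (w x)) \<le> (LINT x|M. 1/2 * \<epsilon> + 1/(2*\<epsilon>) * (w x)\<^sup>2)"
        using int1[OF w] L2_integrable_sq[OF w] amgm[OF \<open>0 < \<epsilon>\<close>]
        by (intro integral_mono) auto
      also have "\<dots> = 1/2 * \<epsilon> * m + 1/(2*\<epsilon>) * (L2_norm M w)\<^sup>2"
        using L2_integrable_sq[OF w] by (simp add: L2_norm_sq m_def)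
      also have "\<dots> < 1/2 * \<epsilon> * m + 1/(2*\<epsilon>) * (\<epsilon> * e)"
        using n0[OF that] \<open>0 < \<epsilon>\<close> unfolding w_def
        by (intro add_strict_left_mono mult_strict_left_mono) auto
      also have "\<dots> = 1/2 * (\<epsilon> * m) + 1/2 * e"
        using \<open>0 < \<epsilon>\<close> by simp
      also have "\<dots> \<le> 1/2 * e + 1/2 * e"
        using \<open>0 < e\<close> \<open>0 \<le> m\<close> by (simp add: \<epsilon>_def field_simps)
      finally show ?thesis by (simp add: w_def)
    qed
    then show ?thesis by blast
  qed
  then show thesis
    using cauchy_L1_AE_cauchy_subseq[of M f] int1[OF f] that by blast
qed

section \<open>Euclidean space as a finite product\<close>

text \<open>Links the product topology to the product sigma-algebra: an open set is the union of the
  boxes with sides in a countable basis that it contains, and finitely many coordinates leave only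
  countably many such boxes.\<close>

lemma open_in_sets_PiM_borel:
  assumes fin: "finite I" and S: "openin (product_topology (\<lambda>_. euclidean) I) S"
  shows "S \<in> sets (Pi\<^sub>M I (\<lambda>_. borel :: 'b :: second_countable_topology measure))"
proof -
  obtain B :: "'b set set" where B: "countable B" "topological_basis B"
    using ex_countable_basis by blast
  define F where "F = {c \<in> I \<rightarrow>\<^sub>E B. Pi\<^sub>E I c \<subseteq> S}"
  have "\<exists>c \<in> F. x \<in> Pi\<^sub>E I c" if "x \<in> S" for x
  proof -
    obtain U where U: "\<And>i. i \<in> I \<Longrightarrow> open (U i)" "x \<in> Pi\<^sub>E I U" "Pi\<^sub>E I U \<subseteq> S"
      using S \<open>x \<in> S\<close> by (simp add: openin_product_topology_alt) metis
    have "\<exists>b \<in> B. x i \<in> b \<and> b \<subseteq> U i" if "i \<in> I" for i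
      using topological_basisE[OF B(2) U(1)[OF that]] U(2) that by (metis PiE_mem)
    then obtain c where c: "\<And>i. i \<in> I \<Longrightarrow> c i \<in> B \<and> x i \<in> c i \<and> c i \<subseteq> U i"
      by metis
    \<comment> \<open>Restriction makes the choice of sides extensional, as counting the boxes
      through \<open>I \<rightarrow>\<^sub>E B\<close> requires.\<close>
    have "restrict c I \<in> F" "x \<in> Pi\<^sub>E I (restrict c I)"
      using c U(2,3) by (auto simp: F_def PiE_iff subset_iff)
    then show ?thesis by blast
  qed
  then have S_eq: "S = (\<Union>c\<in>F. Pi\<^sub>E I c)"
    by (auto simp: F_def)
  have "countable (I \<rightarrow>\<^sub>E B)"
    by (rule countable_PiE[OF fin B(1)])
  then have "countable F"
    by (rule countable_subset[rotated]) (auto simp: F_def)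
  moreover have "Pi\<^sub>E I c \<in> sets (Pi\<^sub>M I (\<lambda>_. borel))" if "c \<in> F" for c
  proof (rule sets_PiM_I_finite[OF fin])
    fix i assume "i \<in> I"
    then have "c i \<in> B"
      using that by (auto simp: F_def PiE_iff)
    then show "c i \<in> sets borel"
      using topological_basis_open[OF B(2)] by (intro borel_open) auto
  qed
  ultimately show ?thesis
    unfolding S_eq by (rule sets.countable_UN'')
qed

lemma sigma_finite_eucl_measure: "sigma_finite_measure (eucl_measure N)"
proof -
  interpret product_sigma_finite "\<lambda>_::nat. lborel :: real measure"
    by standard
  show ?thesis
    unfolding eucl_measure_def by (rule sigma_finite) simp
qed

lemma eucl_dist_measurable [measurable]:
  "(\<lambda>z. eucl_dist N (fst z) (snd z)) \<in> borel_measurable (eucl_measure N \<Otimes>\<^sub>M eucl_measure N)"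
  unfolding eucl_dist_def eucl_norm_def L2_set_def eucl_measure_def by measurable

lemma openin_eucl_measurable:
  assumes "openin (eucl_top N) \<Omega>"
  shows "\<Omega> \<in> sets (eucl_measure N)"
proof -
  have "sets (eucl_measure N) = sets (Pi\<^sub>M {..<N} (\<lambda>_. borel))"
    unfolding eucl_measure_def by (intro sets_PiM_cong) auto
  then show ?thesis
    using open_in_sets_PiM_borel[of "{..<N}" \<Omega>] assms by (simp add: eucl_top_def)
qed

text \<open>Each coordinate is bounded by the Euclidean norm, so the set lies in the cube with sides
  \<open>{-R..R}\<close>.\<close>

lemma emeasure_bounded_finite:
  assumes bd: "\<And>x. x \<in> \<Omega> \<Longrightarrow> eucl_norm N x \<le> R" and \<Omega>: "\<Omega> \<in> sets (eucl_measure N)"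
  shows "emeasure (eucl_measure N) \<Omega> < \<infinity>"
proof -
  interpret product_sigma_finite "\<lambda>_::nat. lborel :: real measure"
    by standard
  have "\<bar>x i\<bar> \<le> R" if "x \<in> \<Omega>" "i < N" for x i
  proof -
    have "\<bar>x i\<bar> \<le> L2_set (\<lambda>i. \<bar>x i\<bar>) {..<N}"
      by (rule member_le_L2_set) (use that in auto)
    then show ?thesis
      using bd[OF that(1)] by (simp add: eucl_norm_def L2_set_def)
  qed
  then have "\<Omega> \<subseteq> Pi\<^sub>E {..<N} (\<lambda>_. {-R..R})"
    using sets.sets_into_space[OF \<Omega>]
    by (force simp: eucl_measure_def space_PiM PiE_iff abs_le_iff)
  then have "emeasure (eucl_measure N) \<Omega> \<le> emeasure (eucl_measure N) (Pi\<^sub>E {..<N} (\<lambda>_. {-R..R}))"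
    by (rule emeasure_mono) (auto simp: eucl_measure_def)
  also have "\<dots> = (\<Prod>i<N. emeasure lborel {-R..R})"
    unfolding eucl_measure_def by (intro emeasure_PiM) auto
  also have "\<dots> < \<infinity>"
    by (auto simp: emeasure_lborel_Icc_eq power_less_top_ennreal)
  finally show ?thesis .
qed

text \<open>If \<open>P\<close> fails only inside a null set \<open>Z\<close>, then the pair
  property fails only inside two null strips over \<open>Z\<close>. This carries almost everywhere
  convergence over to difference quotients.\<close>

lemma AE_pair_both:
  assumes M: "sigma_finite_measure M" and P: "AE x in M. P x"
  shows "AE z in M \<Otimes>\<^sub>M M. P (fst z) \<and> P (snd z)"
proof -
  interpret sigma_finite_measure M by fact
  obtain Z where Z: "Z \<in> null_sets M" "{x \<in> space M. \<not> P x} \<subseteq> Z"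
    using P by (auto simp: eventually_ae_filter)
  show ?thesis
  proof (rule AE_I')
    show "Z \<times> space M \<union> space M \<times> Z \<in> null_sets (M \<Otimes>\<^sub>M M)"
      using Z(1) by (intro null_sets.Un) (auto intro: times_in_null_sets1 times_in_null_sets2)
    show "{z \<in> space (M \<Otimes>\<^sub>M M). \<not> (P (fst z) \<and> P (snd z))} \<subseteq> Z \<times> space M \<union> space M \<times> Z"
      using Z(2) by (auto simp: space_pair_measure)
  qed
qed

section \<open>The fractional Sobolev space\<close>

text \<open>
  With this difference quotient, the Gagliardo seminorm of \<open>u\<close> is an \<open>L\<^sup>2\<close> norm of a function
  depending linearly on \<open>u\<close>, so facts about \<open>L\<^sup>2\<close> transfer.
\<close>

definition diff_quotient :: "nat \<Rightarrow> real \<Rightarrow> (point \<Rightarrow> real) \<Rightarrow> point \<times> point \<Rightarrow> real" where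
  "diff_quotient N s u =
     (\<lambda>z. (u (fst z) - u (snd z)) / sqrt (eucl_dist N (fst z) (snd z) powr (real N + 2 * s)))"

lemma diff_quotient_sq: "(diff_quotient N s u z)\<^sup>2 = gagliardo_integrand N s u z"
  by (simp add: diff_quotient_def gagliardo_integrand_def case_prod_beta power_divide)

lemma diff_quotient_measurable:
  assumes "u \<in> borel_measurable (eucl_measure N)"
  shows "diff_quotient N s u \<in> borel_measurable (eucl_measure N \<Otimes>\<^sub>M eucl_measure N)"
proof -
  note [measurable] = assms
  show ?thesis
    unfolding diff_quotient_def by measurable
qed

text \<open>Turns membership into two L2 conditions on linear images of \<open>u\<close>, so that
  closure under linear combinations is inherited from L2.\<close>

lemma Hs_space_iff:
  "u \<in> Hs_space N s \<longleftrightarrow> u \<in> L2_space (eucl_measure N) \<and>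
     diff_quotient N s u \<in> L2_space (eucl_measure N \<Otimes>\<^sub>M eucl_measure N)"
  using diff_quotient_measurable[of u N s]
  by (auto simp: Hs_space_def L2_space_def diff_quotient_sq)

lemma diff_quotient_add:
  "diff_quotient N s (\<lambda>x. u x + v x) = (\<lambda>z. diff_quotient N s u z + diff_quotient N s v z)"
  by (auto simp: diff_quotient_def simp flip: add_divide_distrib)

lemma diff_quotient_diff:
  "diff_quotient N s (\<lambda>x. u x - v x) = (\<lambda>z. diff_quotient N s u z - diff_quotient N s v z)"
  by (auto simp: diff_quotient_def simp flip: diff_divide_distrib)

lemma diff_quotient_cmult:
  "diff_quotient N s (\<lambda>x. c * u x) = (\<lambda>z. c * diff_quotient N s u z)"
  by (auto simp: diff_quotient_def simp flip: right_diff_distrib)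

lemma H0s_space_add:
  assumes "u \<in> H0s_space N s \<Omega>" "v \<in> H0s_space N s \<Omega>"
  shows "(\<lambda>x. u x + v x) \<in> H0s_space N s \<Omega>"
  using assms by (auto simp: H0s_space_def Hs_space_iff diff_quotient_add intro!: L2_space_add)

lemma H0s_space_cmult:
  assumes "u \<in> H0s_space N s \<Omega>"
  shows "(\<lambda>x. c * u x) \<in> H0s_space N s \<Omega>"
  using assms by (auto simp: H0s_space_def Hs_space_iff diff_quotient_cmult intro!: L2_space_cmult)

lemma H0s_space_diff:
  assumes "u \<in> H0s_space N s \<Omega>" "v \<in> H0s_space N s \<Omega>"
  shows "(\<lambda>x. u x - v x) \<in> H0s_space N s \<Omega>"
  using H0s_space_add[OF assms(1) H0s_space_cmult[OF assms(2), of "-1"]] by simp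

text \<open>Both Gamma arguments, \<open>N / 2 + s\<close> and \<open>1 - s\<close>, are positive.
  The sign makes the radicand of the norm nonnegative and lets the norm control the
  seminorm.\<close>

lemma frac_const_pos:
  assumes "0 < s" "s < 1"
  shows "0 < frac_const N s"
  using assms by (auto simp: frac_const_def intro!: divide_pos_pos mult_pos_pos Gamma_real_pos)

lemma H0s_norm_sq:
  assumes "0 < s" "s < 1"
  shows "(H0s_norm N s \<Omega> u)\<^sup>2 = (L2_norm (meas_on N \<Omega>) u)\<^sup>2 +
    frac_const N s / 2 * (L2_norm (eucl_measure N \<Otimes>\<^sub>M eucl_measure N) (diff_quotient N s u))\<^sup>2"
  using frac_const_pos[OF assms, of N]
  by (simp add: H0s_norm_def L2_norm_sq[of "_ \<Otimes>\<^sub>M _"] diff_quotient_sq)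
    (simp flip: diff_quotient_sq L2_norm_sq)

lemma H0s_norm_diff_commute:
  "H0s_norm N s \<Omega> (\<lambda>x. u x - v x) = H0s_norm N s \<Omega> (\<lambda>x. v x - u x)"
proof -
  have "gagliardo_integrand N s (\<lambda>x. u x - v x) = gagliardo_integrand N s (\<lambda>x. v x - u x)"
    by (auto simp: gagliardo_integrand_def power2_eq_square algebra_simps)
  moreover have "(\<lambda>x. (u x - v x)\<^sup>2) = (\<lambda>x. (v x - u x)\<^sup>2)"
    by (simp add: power2_commute)
  ultimately show ?thesis
    by (simp only: H0s_norm_def L2_norm_def)
qed

lemma L2_space_meas_on:
  assumes "\<Omega> \<in> sets (eucl_measure N)" "u \<in> L2_space (eucl_measure N)"
  shows "u \<in> L2_space (meas_on N \<Omega>)"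
proof -
  have "integrable (eucl_measure N) (\<lambda>x. indicator \<Omega> x *\<^sub>R (u x)\<^sup>2)"
    using assms by (intro integrable_mult_indicator) (auto simp: L2_space_def)
  moreover have "\<Omega> \<inter> space (eucl_measure N) \<in> sets (eucl_measure N)"
    using assms(1) by auto
  ultimately show ?thesis
    using assms(2)
    by (auto simp: L2_space_def meas_on_def integrable_restrict_space intro: measurable_restrict_space1)
qed

lemma H0s_space_meas_on:
  "\<Omega> \<in> sets (eucl_measure N) \<Longrightarrow> u \<in> H0s_space N s \<Omega> \<Longrightarrow> u \<in> L2_space (meas_on N \<Omega>)"
  by (auto simp: H0s_space_def Hs_space_def L2_space_meas_on)

lemma H0s_norm_midpoint:
  assumes "0 < s" "s < 1" "\<Omega> \<in> sets (eucl_measure N)"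
    and u: "u \<in> H0s_space N s \<Omega>" and v: "v \<in> H0s_space N s \<Omega>"
  shows "(H0s_norm N s \<Omega> u)\<^sup>2 + (H0s_norm N s \<Omega> v)\<^sup>2 =
    2 * (H0s_norm N s \<Omega> (\<lambda>x. 1/2 * (u x + v x)))\<^sup>2 + 1/2 * (H0s_norm N s \<Omega> (\<lambda>x. u x - v x))\<^sup>2"
proof -
  have "diff_quotient N s u \<in> L2_space (eucl_measure N \<Otimes>\<^sub>M eucl_measure N)"
    "diff_quotient N s v \<in> L2_space (eucl_measure N \<Otimes>\<^sub>M eucl_measure N)"
    using u v by (auto simp: H0s_space_def Hs_space_iff)
  note 1 = L2_norm_midpoint[OF this]
  note 2 = L2_norm_midpoint[OF H0s_space_meas_on[OF assms(3) u] H0s_space_meas_on[OF assms(3) v]]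
  show ?thesis
    unfolding H0s_norm_sq[OF assms(1,2)] diff_quotient_cmult diff_quotient_add diff_quotient_diff
    using 2 arg_cong[OF 1, of "\<lambda>t. frac_const N s / 2 * t"]
    by (simp only: distrib_left)
qed

lemma H0s_norm_add_Young:
  assumes "0 < s" "s < 1" "\<Omega> \<in> sets (eucl_measure N)" "0 < \<eta>"
    and u: "u \<in> H0s_space N s \<Omega>" and v: "v \<in> H0s_space N s \<Omega>"
  shows "(H0s_norm N s \<Omega> (\<lambda>x. u x + v x))\<^sup>2 \<le>
    (1 + \<eta>) * (H0s_norm N s \<Omega> u)\<^sup>2 + (1 + 1/\<eta>) * (H0s_norm N s \<Omega> v)\<^sup>2"
proof -
  have "diff_quotient N s u \<in> L2_space (eucl_measure N \<Otimes>\<^sub>M eucl_measure N)"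
    "diff_quotient N s v \<in> L2_space (eucl_measure N \<Otimes>\<^sub>M eucl_measure N)"
    using u v by (auto simp: H0s_space_def Hs_space_iff)
  note 1 = L2_norm_add_Young[OF this \<open>0 < \<eta>\<close>]
  note 2 = L2_norm_add_Young[OF H0s_space_meas_on[OF assms(3) u] H0s_space_meas_on[OF assms(3) v] \<open>0 < \<eta>\<close>]
  have "0 \<le> frac_const N s / 2"
    using frac_const_pos[OF assms(1,2), of N] by simp
  show ?thesis
    unfolding H0s_norm_sq[OF assms(1,2)] diff_quotient_add
    using add_mono[OF 2 mult_left_mono[OF 1 \<open>0 \<le> frac_const N s / 2\<close>]]
    by (simp add: algebra_simps add_divide_distrib)
qed

text \<open>Fatou is applied to \<open>u n - u (r i)\<close> with \<open>n\<close> fixed and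
  \<open>i\<close> tending to infinity. This places \<open>u n - v\<close> in the space and bounds
  its norm for every large \<open>n\<close>, so the whole sequence converges and not only the
  subsequence.\<close>

lemma H0s_complete:
  fixes u :: "nat \<Rightarrow> point \<Rightarrow> real"
  assumes s: "0 < s" "s < 1"
    and \<Omega>: "\<Omega> \<in> sets (eucl_measure N)" "emeasure (eucl_measure N) \<Omega> < \<infinity>"
    and u: "\<And>n. u n \<in> H0s_space N s \<Omega>"
    and Cauchy: "\<And>e. 0 < e \<Longrightarrow> \<exists>n0. \<forall>i\<ge>n0. \<forall>j\<ge>n0. (H0s_norm N s \<Omega> (\<lambda>x. u i x - u j x))\<^sup>2 < e"
  obtains v where "v \<in> H0s_space N s \<Omega>" "(\<lambda>n. (H0s_norm N s \<Omega> (\<lambda>x. u n x - v x))\<^sup>2) \<longlonglongrightarrow> 0"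
proof -
  define \<mu> where "\<mu> = eucl_measure N"
  define P where "P = \<mu> \<Otimes>\<^sub>M \<mu>"
  define c where "c = frac_const N s / 2"
  have "0 < c"
    using frac_const_pos[OF s] by (simp add: c_def)
  have norm_sq: "(H0s_norm N s \<Omega> w)\<^sup>2 =
      (L2_norm (meas_on N \<Omega>) w)\<^sup>2 + c * (L2_norm P (diff_quotient N s w))\<^sup>2" for w
    by (simp add: H0s_norm_sq[OF s] c_def P_def \<mu>_def)
  have \<Omega>_sets: "\<Omega> \<inter> space \<mu> \<in> sets \<mu>"
    using \<Omega>(1) by (auto simp: \<mu>_def)
  have fin: "finite_measure (meas_on N \<Omega>)"
    using \<Omega> sets.sets_into_space[OF \<Omega>(1)]
    by (intro finite_measureI)
      (auto simp: meas_on_def space_restrict_space emeasure_restrict_space \<Omega>_sets[unfolded \<mu>_def] Int_absorb2)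
  have L2_le: "(L2_norm (meas_on N \<Omega>) w)\<^sup>2 \<le> (H0s_norm N s \<Omega> w)\<^sup>2"
    and dq_le: "(L2_norm P (diff_quotient N s w))\<^sup>2 \<le> (H0s_norm N s \<Omega> w)\<^sup>2 / c" for w
    using \<open>0 < c\<close> by (auto simp: norm_sq field_simps)
  obtain r where r: "strict_mono r" and AE_\<Omega>: "AE x in meas_on N \<Omega>. Cauchy (\<lambda>i. u (r i) x)"
  proof (rule L2_Cauchy_AE_Cauchy_subseq[OF fin, of u])
    show "\<exists>n0. \<forall>i\<ge>n0. \<forall>j\<ge>n0. (L2_norm (meas_on N \<Omega>) (\<lambda>x. u i x - u j x))\<^sup>2 < e" if "0 < e" for e
      using Cauchy[OF that] L2_le by (meson le_less_trans)
  qed (auto intro: H0s_space_meas_on \<Omega>(1) u)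
  have u_L2: "u n \<in> L2_space \<mu>" for n
    using u[of n] by (auto simp: H0s_space_def Hs_space_def \<mu>_def)
  then have [measurable]: "u n \<in> borel_measurable \<mu>" for n
    by (auto simp: L2_space_def)
  \<comment> \<open>A pointwise \<open>lim\<close> is measurable even where the sequence diverges;
    those points form a null set. Off the domain it is almost everywhere the limit of zeros.\<close>
  define v where "v x = lim (\<lambda>i. u (r i) x)" for x
  have [measurable]: "v \<in> borel_measurable \<mu>"
    unfolding v_def by measurable
  have zero: "AE x in \<mu>. \<forall>n. x \<notin> \<Omega> \<longrightarrow> u n x = 0"
    unfolding AE_all_countable \<mu>_def using u by (simp add: H0s_space_def)
  have AE_Cauchy: "AE x in \<mu>. x \<in> \<Omega> \<longrightarrow> Cauchy (\<lambda>i. u (r i) x)"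
    using AE_\<Omega> unfolding meas_on_def AE_restrict_space_iff[OF \<Omega>_sets[unfolded \<mu>_def]] \<mu>_def .
  have lim: "AE x in \<mu>. (\<lambda>i. u (r i) x) \<longlonglongrightarrow> v x"
    using zero AE_Cauchy
  proof eventually_elim
    case (elim x)
    then have "convergent (\<lambda>i. u (r i) x)"
      by (cases "x \<in> \<Omega>") (auto simp: Cauchy_convergent convergent_const)
    then show ?case
      by (simp add: v_def convergent_LIMSEQ_iff)
  qed
  have v_zero: "AE x in \<mu>. x \<notin> \<Omega> \<longrightarrow> v x = 0"
    using zero by eventually_elim (auto simp: v_def)
  have lim2: "AE z in P. (\<lambda>i. u (r i) (fst z)) \<longlonglongrightarrow> v (fst z) \<and> (\<lambda>i. u (r i) (snd z)) \<longlonglongrightarrow> v (snd z)"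
    unfolding P_def \<mu>_def
    by (rule AE_pair_both[OF sigma_finite_eucl_measure lim[unfolded \<mu>_def]])
  \<comment> \<open>The norm integrates over the domain, membership over the whole space; for
    functions vanishing almost everywhere outside the domain the two L2 norms agree.\<close>
  have L2_eq: "L2_norm \<mu> w = L2_norm (meas_on N \<Omega>) w" if "w \<in> H0s_space N s \<Omega>" for w
  proof -
    have [measurable]: "w \<in> borel_measurable \<mu>"
      using that by (auto simp: H0s_space_def Hs_space_def L2_space_def \<mu>_def)
    have AE_w: "AE x in \<mu>. x \<notin> \<Omega> \<longrightarrow> w x = 0"
      using that unfolding \<mu>_def by (simp add: H0s_space_def)
    have [measurable]: "\<Omega> \<in> sets \<mu>" using \<Omega>(1) by (simp add: \<mu>_def)
    have "(\<integral>x. (w x)\<^sup>2 \<partial>\<mu>) = (\<integral>x. indicator \<Omega> x *\<^sub>R (w x)\<^sup>2 \<partial>\<mu>)"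
      by (intro integral_cong_AE, measurable) (use AE_w in eventually_elim, auto simp: indicator_def)
    then show ?thesis
      using \<Omega>_sets by (simp add: L2_norm_def meas_on_def \<mu>_def integral_restrict_space)
  qed
  \<comment> \<open>The factor 2 arises because the L2 part and the weighted seminorm part of the
    limit are each bounded by \<open>e\<close> separately.\<close>
  have main: "(\<lambda>x. u n x - v x) \<in> H0s_space N s \<Omega> \<and> (H0s_norm N s \<Omega> (\<lambda>x. u n x - v x))\<^sup>2 \<le> 2 * e"
    if n0: "\<And>i j. i \<ge> n0 \<Longrightarrow> j \<ge> n0 \<Longrightarrow> (H0s_norm N s \<Omega> (\<lambda>x. u i x - u j x))\<^sup>2 < e" and "n \<ge> n0" for n n0 e
  proof -
    \<comment> \<open>The shift by \<open>n0\<close> places every index \<open>r (i + n0)\<close>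
      beyond \<open>n0\<close>, since a strictly increasing \<open>r\<close> satisfies
      \<open>k \<le> r k\<close>.\<close>
    define f where "f = (\<lambda>i x. u n x - u (r (i + n0)) x)"
    define g where "g = (\<lambda>x. u n x - v x)"
    have f: "f i \<in> H0s_space N s \<Omega>" for i
      unfolding f_def by (intro H0s_space_diff u)
    have "r (i + n0) \<ge> n0" for i
      using seq_suble[OF r, of "i + n0"] by simp
    then have fle: "(H0s_norm N s \<Omega> (f i))\<^sup>2 \<le> e" for i
      unfolding f_def using n0[of n "r (i + n0)"] \<open>n \<ge> n0\<close> by (simp add: less_imp_le)
    have fL2: "f i \<in> L2_space \<mu>" and fdq: "diff_quotient N s (f i) \<in> L2_space P" for i
      using f[of i] by (auto simp: H0s_space_def Hs_space_iff \<mu>_def P_def)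
    have g_meas [measurable]: "g \<in> borel_measurable \<mu>"
      unfolding g_def by measurable
    have "AE x in \<mu>. (\<lambda>i. f i x) \<longlonglongrightarrow> g x"
      using lim
    proof eventually_elim
      case (elim x)
      then show ?case
        unfolding f_def g_def by (intro tendsto_diff tendsto_const LIMSEQ_ignore_initial_segment)
    qed
    moreover have "(L2_norm \<mu> (f i))\<^sup>2 \<le> e" for i
      using L2_le[of "f i"] fle[of i] L2_eq[OF f[of i]] by simp
    ultimately have g1: "g \<in> L2_space \<mu>" "(L2_norm \<mu> g)\<^sup>2 \<le> e"
      using L2_space_Fatou[of f \<mu> e g] fL2 g_meas by blast+
    have dq_meas: "diff_quotient N s g \<in> borel_measurable P"
      using g_meas unfolding P_def \<mu>_def by (rule diff_quotient_measurable)
    have "AE z in P. (\<lambda>i. diff_quotient N s (f i) z) \<longlonglongrightarrow> diff_quotient N s g z"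
      using lim2
    proof eventually_elim
      case (elim z)
      then show ?case
        unfolding f_def g_def diff_quotient_def divide_inverse
        by (intro tendsto_intros LIMSEQ_ignore_initial_segment) auto
    qed
    moreover have "(L2_norm P (diff_quotient N s (f i)))\<^sup>2 \<le> e / c" for i
      using dq_le[of "f i"] divide_right_mono[OF fle[of i], of c] \<open>0 < c\<close> by simp
    ultimately have g2: "diff_quotient N s g \<in> L2_space P" "(L2_norm P (diff_quotient N s g))\<^sup>2 \<le> e / c"
      using L2_space_Fatou[of "\<lambda>i. diff_quotient N s (f i)" P "e / c" "diff_quotient N s g"]
        fdq dq_meas by blast+
    have "AE x in \<mu>. x \<notin> \<Omega> \<longrightarrow> g x = 0"
      using zero v_zero by eventually_elim (auto simp: g_def)
    then have g: "g \<in> H0s_space N s \<Omega>"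
      using g1(1) g2(1) unfolding \<mu>_def P_def by (simp add: H0s_space_def Hs_space_iff)
    have "c * (L2_norm P (diff_quotient N s g))\<^sup>2 \<le> e"
      using g2(2) \<open>0 < c\<close> by (simp add: field_simps)
    then show ?thesis
      using g g1(2) L2_eq[OF g] norm_sq[of g] by (simp add: g_def)
  qed
  show thesis
  proof
    obtain n0 where "\<And>i j. i \<ge> n0 \<Longrightarrow> j \<ge> n0 \<Longrightarrow> (H0s_norm N s \<Omega> (\<lambda>x. u i x - u j x))\<^sup>2 < 1"
      using Cauchy[of 1] by auto
    from main[OF this, of n0 n0] have "(\<lambda>x. u n0 x - v x) \<in> H0s_space N s \<Omega>"
      by blast
    \<comment> \<open>Here \<open>v\<close> is recovered as
      \<open>u n0 - (u n0 - v)\<close>.\<close>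
    from H0s_space_diff[OF u[of n0] this] show "v \<in> H0s_space N s \<Omega>"
      by simp
    show "(\<lambda>n. (H0s_norm N s \<Omega> (\<lambda>x. u n x - v x))\<^sup>2) \<longlonglongrightarrow> 0"
    proof (rule LIMSEQ_I)
      fix e :: real
      assume "0 < e"
      then obtain n0 where n0: "\<And>i j. i \<ge> n0 \<Longrightarrow> j \<ge> n0 \<Longrightarrow> (H0s_norm N s \<Omega> (\<lambda>x. u i x - u j x))\<^sup>2 < e / 4"
        using Cauchy[of "e / 4"] by auto
      have "norm ((H0s_norm N s \<Omega> (\<lambda>x. u n x - v x))\<^sup>2 - 0) < e" if "n \<ge> n0" for n
        using main[OF n0 that] \<open>0 < e\<close> by simp
      then show "\<exists>n0. \<forall>n\<ge>n0. norm ((H0s_norm N s \<Omega> (\<lambda>x. u n x - v x))\<^sup>2 - 0) < e"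
        by blast
    qed
  qed
qed

section \<open>The Tikhonov functional\<close>

locale tikhonov_problem =
  fixes N :: nat and \<Omega> :: "point set" and s \<alpha> :: real
    and K :: "(point \<Rightarrow> real) \<Rightarrow> (point \<Rightarrow> real)"
  assumes s: "0 < s" "s < 1"
    and \<alpha>: "0 < \<alpha>"
    and dom_sets: "\<Omega> \<in> sets (eucl_measure N)"
    and dom_finite: "emeasure (eucl_measure N) \<Omega> < \<infinity>"
    and K: "bounded_linear_H0s_L2 N s \<Omega> K"
begin

abbreviation "V \<equiv> H0s_space N s \<Omega>"
abbreviation "Y \<equiv> L2_space (meas_on N \<Omega>)"
abbreviation "nV \<equiv> H0s_norm N s \<Omega>"
abbreviation "nY \<equiv> L2_norm (meas_on N \<Omega>)"
abbreviation "J \<equiv> tikhonov N s \<Omega> K \<alpha>"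

text \<open>Twice the quadratic part of the functional, hence the same for all data
  \<open>y\<close>.\<close>

definition energy :: "(point \<Rightarrow> real) \<Rightarrow> real" where
  "energy w = (nY (K w))\<^sup>2 + \<alpha> * (nV w)\<^sup>2"

lemma K_in [simp]: "u \<in> V \<Longrightarrow> K u \<in> Y"
  using K by (simp add: bounded_linear_H0s_L2_def)

lemma K_add: "u \<in> V \<Longrightarrow> v \<in> V \<Longrightarrow> AE x in meas_on N \<Omega>. K (\<lambda>t. u t + v t) x = K u x + K v x"
  using K by (simp add: bounded_linear_H0s_L2_def)

lemma K_cmult: "u \<in> V \<Longrightarrow> AE x in meas_on N \<Omega>. K (\<lambda>t. c * u t) x = c * K u x"
  using K by (simp add: bounded_linear_H0s_L2_def)

lemma K_diff:
  assumes "u \<in> V" "v \<in> V"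
  shows "AE x in meas_on N \<Omega>. K (\<lambda>t. u t - v t) x = K u x - K v x"
  using K_add[OF assms(1) H0s_space_cmult[OF assms(2), of "-1"]] K_cmult[OF assms(2), of "-1"]
  by eventually_elim simp

lemma K_bounded:
  obtains B where "0 \<le> B" "\<And>u. u \<in> V \<Longrightarrow> (nY (K u))\<^sup>2 \<le> B * (nV u)\<^sup>2"
proof -
  obtain B where B: "\<And>u. u \<in> V \<Longrightarrow> nY (K u) \<le> B * nV u"
    using K unfolding bounded_linear_H0s_L2_def by metis
  have "(nY (K u))\<^sup>2 \<le> B\<^sup>2 * (nV u)\<^sup>2" if "u \<in> V" for u
    using power_mono[OF B[OF that] L2_norm_nonneg, of 2] by (simp add: power_mult_distrib)
  then show thesis
    using that[of "B\<^sup>2"] by simp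
qed

lemma tikhonov_altdef: "J y u = 1/2 * ((nY (\<lambda>x. K u x - y x))\<^sup>2 + \<alpha> * (nV u)\<^sup>2)"
  by (simp add: tikhonov_def field_simps)

lemma tikhonov_nonneg: "0 \<le> J y u"
  using \<alpha> by (simp add: tikhonov_def)

text \<open>The residual \<open>K u - y\<close> is affine in \<open>u\<close>: the midpoint has the
  averaged residual, and \<open>y\<close> cancels in the difference. Linearity of \<open>K\<close>
  holds only almost everywhere, so norms are compared through
  \<open>L2_norm_cong_AE\<close>.\<close>

lemma tikhonov_midpoint:
  assumes y: "y \<in> Y" and u: "u \<in> V" and v: "v \<in> V"
  shows "J y u + J y v = 2 * J y (\<lambda>x. 1/2 * (u x + v x)) + 1/4 * energy (\<lambda>x. u x - v x)"
proof -
  let ?m = "\<lambda>x. 1/2 * (u x + v x)" and ?d = "\<lambda>x. u x - v x"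
  let ?ru = "\<lambda>x. K u x - y x" and ?rv = "\<lambda>x. K v x - y x"
  have uv: "(\<lambda>x. u x + v x) \<in> V"
    using u v by (rule H0s_space_add)
  have m: "?m \<in> V" and d: "?d \<in> V"
    by (intro H0s_space_cmult H0s_space_diff uv u v)+
  have ru: "?ru \<in> Y" and rv: "?rv \<in> Y"
    using u v y by (auto intro: L2_space_diff)
  have "nY (\<lambda>x. K ?m x - y x) = nY (\<lambda>x. 1/2 * (?ru x + ?rv x))"
  proof (rule L2_norm_cong_AE)
    show "AE x in meas_on N \<Omega>. K ?m x - y x = 1/2 * (?ru x + ?rv x)"
      using K_cmult[OF uv, of "1/2"] K_add[OF u v] by eventually_elim simp
  qed (intro L2_space_diff L2_space_cmult L2_space_add K_in m ru rv y)+
  moreover have "nY (K ?d) = nY (\<lambda>x. ?ru x - ?rv x)"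
  proof (rule L2_norm_cong_AE)
    show "AE x in meas_on N \<Omega>. K ?d x = ?ru x - ?rv x"
      using K_diff[OF u v] by eventually_elim simp
  qed (intro L2_space_diff K_in d ru rv)+
  ultimately have "(nY ?ru)\<^sup>2 + (nY ?rv)\<^sup>2 = 2 * (nY (\<lambda>x. K ?m x - y x))\<^sup>2 + 1/2 * (nY (K ?d))\<^sup>2"
    using L2_norm_midpoint[OF ru rv] by simp
  moreover have "\<alpha> * ((nV u)\<^sup>2 + (nV v)\<^sup>2) = \<alpha> * (2 * (nV ?m)\<^sup>2 + 1/2 * (nV ?d)\<^sup>2)"
    by (simp only: H0s_norm_midpoint[OF s dom_sets u v])
  ultimately show ?thesis
    unfolding tikhonov_altdef energy_def by (simp only: distrib_left)
qed

text \<open>A quantitative form of continuity, used to pass to the limit along a minimizing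
  sequence.\<close>

lemma tikhonov_add_Young:
  assumes y: "y \<in> Y" and u: "u \<in> V" and w: "w \<in> V" and \<eta>: "0 < \<eta>"
  shows "J y (\<lambda>x. u x + w x) \<le> (1 + \<eta>) * J y u + (1 + 1/\<eta>) / 2 * energy w"
proof -
  let ?r = "\<lambda>x. K u x - y x"
  have uw: "(\<lambda>x. u x + w x) \<in> V"
    using u w by (rule H0s_space_add)
  have r: "?r \<in> Y"
    using u y by (auto intro: L2_space_diff)
  have "nY (\<lambda>x. K (\<lambda>x. u x + w x) x - y x) = nY (\<lambda>x. ?r x + K w x)"
  proof (rule L2_norm_cong_AE)
    show "AE x in meas_on N \<Omega>. K (\<lambda>x. u x + w x) x - y x = ?r x + K w x"
      using K_add[OF u w] by eventually_elim simp
  qed (intro L2_space_diff L2_space_add K_in uw r w y)+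
  then have "(nY (\<lambda>x. K (\<lambda>x. u x + w x) x - y x))\<^sup>2
      \<le> (1 + \<eta>) * (nY ?r)\<^sup>2 + (1 + 1/\<eta>) * (nY (K w))\<^sup>2"
    using L2_norm_add_Young[OF r K_in[OF w] \<eta>] by simp
  moreover have "\<alpha> * (nV (\<lambda>x. u x + w x))\<^sup>2
      \<le> \<alpha> * ((1 + \<eta>) * (nV u)\<^sup>2 + (1 + 1/\<eta>) * (nV w)\<^sup>2)"
    using H0s_norm_add_Young[OF s dom_sets \<eta> u w] \<alpha> by simp
  ultimately have "J y (\<lambda>x. u x + w x) \<le>
      1/2 * ((1 + \<eta>) * (nY ?r)\<^sup>2 + (1 + 1/\<eta>) * (nY (K w))\<^sup>2)
      + 1/2 * (\<alpha> * ((1 + \<eta>) * (nV u)\<^sup>2 + (1 + 1/\<eta>) * (nV w)\<^sup>2))"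
    unfolding tikhonov_altdef by (simp only: distrib_left)
  also have "\<dots> = (1 + \<eta>) * J y u + (1 + 1/\<eta>) / 2 * energy w"
    unfolding tikhonov_altdef energy_def by (simp add: field_simps)
  finally show ?thesis .
qed

lemma minimizer_exists:
  assumes y: "y \<in> Y"
  shows "\<exists>u. is_minimizer N s \<Omega> K \<alpha> y u"
proof -
  define m where "m = Inf (J y ` V)"
  have bdd: "bdd_below (J y ` V)"
    using tikhonov_nonneg by (intro bdd_belowI[of _ 0]) auto
  have "(\<lambda>_. 0) \<in> V"
    by (simp add: H0s_space_def Hs_space_iff L2_space_def diff_quotient_def)
  then have ne: "J y ` V \<noteq> {}"
    by blast
  have m_le: "m \<le> J y u" if "u \<in> V" for u
    unfolding m_def using that bdd by (auto intro: cInf_lower)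
  have "\<exists>u \<in> V. J y u < m + 1 / real (Suc n)" for n
    using cInf_lessD[OF ne, of "m + 1 / real (Suc n)"] by (auto simp: m_def)
  then obtain u where u: "\<And>n. u n \<in> V" and Ju: "\<And>n. J y (u n) < m + 1 / real (Suc n)"
    by metis
  have inv0: "(\<lambda>n. 1 / real (Suc n)) \<longlonglongrightarrow> 0"
    using LIMSEQ_inverse_real_of_nat by (simp add: divide_inverse)
  \<comment> \<open>The midpoint value is at least \<open>m\<close>, so the two copies of
    \<open>m\<close> cancel and only the excesses over the infimum remain.\<close>
  have energy_bound: "1/4 * energy (\<lambda>x. u i x - u j x) < 1 / real (Suc i) + 1 / real (Suc j)" for i j
    using tikhonov_midpoint[OF y u[of i] u[of j]] Ju[of i] Ju[of j]
      m_le[OF H0s_space_cmult[OF H0s_space_add[OF u[of i] u[of j]], of "1/2"]]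
    by linarith
  have Cauchy: "\<exists>n0. \<forall>i\<ge>n0. \<forall>j\<ge>n0. (nV (\<lambda>x. u i x - u j x))\<^sup>2 < e" if "0 < e" for e
  proof -
    \<comment> \<open>Two excesses below \<open>\<alpha> * e / 8\<close> bound a quarter of the
      energy by \<open>\<alpha> * e / 4\<close>, and the energy dominates \<alpha> times the squared
      norm.\<close>
    have "0 < \<alpha> * e / 8"
      using \<alpha> that by simp
    from order_tendstoD(2)[OF inv0 this]
    obtain n0 where n0: "\<And>n. n \<ge> n0 \<Longrightarrow> 1 / real (Suc n) < \<alpha> * e / 8"
      unfolding eventually_sequentially by blast
    have "(nV (\<lambda>x. u i x - u j x))\<^sup>2 < e" if "i \<ge> n0" "j \<ge> n0" for i j
    proof -
      have "\<alpha> * (nV (\<lambda>x. u i x - u j x))\<^sup>2 \<le> energy (\<lambda>x. u i x - u j x)"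
        by (simp add: energy_def)
      also have "\<dots> < \<alpha> * e"
        using energy_bound[of i j] n0[OF that(1)] n0[OF that(2)] by linarith
      finally show ?thesis
        using \<alpha> by simp
    qed
    then show ?thesis by blast
  qed
  obtain v where v: "v \<in> V" and conv: "(\<lambda>n. (nV (\<lambda>x. u n x - v x))\<^sup>2) \<longlonglongrightarrow> 0"
    using H0s_complete[OF s dom_sets dom_finite u Cauchy] by blast
  obtain B where B: "0 \<le> B" "\<And>u. u \<in> V \<Longrightarrow> (nY (K u))\<^sup>2 \<le> B * (nV u)\<^sup>2"
    using K_bounded by blast
  \<comment> \<open>Write \<open>v = u n + (v - u n)\<close> and let \<open>n\<close> grow with
    \<eta> fixed: the term with factor \<open>1 + 1/\<eta>\<close> vanishes since \<open>K\<close>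
    is bounded. Only afterwards does \<eta> tend to 0, along
    \<open>1 / real (Suc n)\<close>.\<close>
  have Jv_eta: "J y v \<le> (1 + \<eta>) * m" if "0 < \<eta>" for \<eta>
  proof (rule LIMSEQ_le_const)
    have "(\<lambda>n. (1 + \<eta>) * (m + 1 / real (Suc n)) + (1 + 1/\<eta>) / 2 * ((B + \<alpha>) * (nV (\<lambda>x. u n x - v x))\<^sup>2))
        \<longlonglongrightarrow> (1 + \<eta>) * (m + 0) + (1 + 1/\<eta>) / 2 * ((B + \<alpha>) * 0)"
      by (intro tendsto_intros inv0 conv)
    then show "(\<lambda>n. (1 + \<eta>) * (m + 1 / real (Suc n)) + (1 + 1/\<eta>) / 2 * ((B + \<alpha>) * (nV (\<lambda>x. u n x - v x))\<^sup>2))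
        \<longlonglongrightarrow> (1 + \<eta>) * m"
      by simp
    have "J y v \<le> (1 + \<eta>) * (m + 1 / real (Suc n)) + (1 + 1/\<eta>) / 2 * ((B + \<alpha>) * (nV (\<lambda>x. u n x - v x))\<^sup>2)" for n
    proof -
      have w: "(\<lambda>x. v x - u n x) \<in> V"
        using v u by (rule H0s_space_diff)
      have "energy (\<lambda>x. v x - u n x) \<le> (B + \<alpha>) * (nV (\<lambda>x. u n x - v x))\<^sup>2"
        using B(2)[OF w] by (simp add: energy_def H0s_norm_diff_commute[of _ _ _ v] distrib_right)
      then have "(1 + 1/\<eta>) / 2 * energy (\<lambda>x. v x - u n x)
          \<le> (1 + 1/\<eta>) / 2 * ((B + \<alpha>) * (nV (\<lambda>x. u n x - v x))\<^sup>2)"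
        using that by (intro mult_left_mono) auto
      moreover have "(1 + \<eta>) * J y (u n) \<le> (1 + \<eta>) * (m + 1 / real (Suc n))"
        using Ju[of n] that by (intro mult_left_mono) auto
      moreover have "J y v \<le> (1 + \<eta>) * J y (u n) + (1 + 1/\<eta>) / 2 * energy (\<lambda>x. v x - u n x)"
        using tikhonov_add_Young[OF y u[of n] w that] by simp
      ultimately show ?thesis by linarith
    qed
    then show "\<exists>n0. \<forall>n\<ge>n0. J y v \<le> (1 + \<eta>) * (m + 1 / real (Suc n))
        + (1 + 1/\<eta>) / 2 * ((B + \<alpha>) * (nV (\<lambda>x. u n x - v x))\<^sup>2)"
      by blast
  qed
  have "J y v \<le> m"
  proof (rule LIMSEQ_le_const)
    have "(\<lambda>n. (1 + 1 / real (Suc n)) * m) \<longlonglongrightarrow> (1 + 0) * m"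
      by (intro tendsto_intros inv0)
    then show "(\<lambda>n. (1 + 1 / real (Suc n)) * m) \<longlonglongrightarrow> m"
      by simp
    show "\<exists>n0. \<forall>n\<ge>n0. J y v \<le> (1 + 1 / real (Suc n)) * m"
      using Jv_eta by simp
  qed
  then have "is_minimizer N s \<Omega> K \<alpha> y v"
    using v m_le by (force simp: is_minimizer_def is_arg_min_def not_less)
  then show ?thesis
    by blast
qed

text \<open>Quadratic growth at a minimizer: in the parallelogram identity the midpoint value is at
  least \<open>J y u\<close>.\<close>

lemma minimizer_energy_bound:
  assumes "y \<in> Y" "is_minimizer N s \<Omega> K \<alpha> y u" "v \<in> V"
  shows "1/4 * energy (\<lambda>x. u x - v x) \<le> J y v - J y u"
proof -
  have u: "u \<in> V" and min: "\<And>w. w \<in> V \<Longrightarrow> J y u \<le> J y w"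
    using assms(2) by (auto simp: is_minimizer_def is_arg_min_def not_less)
  show ?thesis
    using tikhonov_midpoint[OF assms(1) u assms(3)]
      min[OF H0s_space_cmult[OF H0s_space_add[OF u assms(3)], of "1/2"]]
    by linarith
qed

text \<open>
  Adding the bounds of \<open>minimizer_energy_bound\<close> for the two data, the quadratic terms cancel and
  the right-hand side becomes the inner product of \<open>K (u1 - u2)\<close> and \<open>y1 - y2\<close>. Half the squared norm of
  \<open>K (u1 - u2)\<close> produced by Young's inequality is absorbed on the left, which is why the operator
  norm of \<open>K\<close> does not enter the constant.
\<close>

lemma minimizer_lipschitz:
  assumes y: "y1 \<in> Y" "y2 \<in> Y"
    and min: "is_minimizer N s \<Omega> K \<alpha> y1 u1" "is_minimizer N s \<Omega> K \<alpha> y2 u2"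
  shows "nV (\<lambda>x. u1 x - u2 x) \<le> 1 / sqrt \<alpha> * nY (\<lambda>x. y1 x - y2 x)"
proof -
  let ?w = "\<lambda>x. u1 x - u2 x"
  have u: "u1 \<in> V" "u2 \<in> V"
    using min by (auto simp: is_minimizer_def is_arg_min_def)
  have w: "?w \<in> V"
    using u by (rule H0s_space_diff)
  have Ku: "K u1 \<in> Y" "K u2 \<in> Y"
    using u by auto
  have w': "(\<lambda>x. u2 x - u1 x) = (\<lambda>x. -1 * ?w x)"
    by auto
  have energy_sym: "energy (\<lambda>x. u2 x - u1 x) = energy ?w"
  proof -
    have "nY (K (\<lambda>x. -1 * ?w x)) = nY (\<lambda>x. -1 * K ?w x)"
      using K_cmult[OF w, of "-1"]
      by (intro L2_norm_cong_AE K_in H0s_space_cmult L2_space_cmult w)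
    then have "(nY (K (\<lambda>x. u2 x - u1 x)))\<^sup>2 = (nY (K ?w))\<^sup>2"
      unfolding w' using L2_norm_cmult_sq[of "meas_on N \<Omega>" "-1" "K ?w"] by simp
    then show ?thesis
      by (simp add: energy_def H0s_norm_diff_commute[of _ _ _ u2])
  qed
  have int: "integrable (meas_on N \<Omega>) (\<lambda>x. (K ui x - yi x)\<^sup>2)" if "ui \<in> V" "yi \<in> Y" for ui yi
    using that by (intro L2_integrable_sq L2_space_diff K_in)
  have int': "integrable (meas_on N \<Omega>) (\<lambda>x. (K u1 x - K u2 x)\<^sup>2)"
    "integrable (meas_on N \<Omega>) (\<lambda>x. (y1 x - y2 x)\<^sup>2)"
    using Ku y by (auto intro: L2_integrable_sq L2_space_diff)
  \<comment> \<open>Expanded, the left integrand is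
    \<open>2 * (K u1 x - K u2 x) * (y1 x - y2 x)\<close>, and Young's inequality applies
    pointwise.\<close>
  have "(\<integral>x. ((K u2 x - y1 x)\<^sup>2 - (K u1 x - y1 x)\<^sup>2) + ((K u1 x - y2 x)\<^sup>2 - (K u2 x - y2 x)\<^sup>2) \<partial>meas_on N \<Omega>)
      \<le> (\<integral>x. (K u1 x - K u2 x)\<^sup>2 + (y1 x - y2 x)\<^sup>2 \<partial>meas_on N \<Omega>)"
  proof (rule integral_mono)
    fix x
    have "0 \<le> ((K u1 x - K u2 x) - (y1 x - y2 x))\<^sup>2"
      by simp
    then show "((K u2 x - y1 x)\<^sup>2 - (K u1 x - y1 x)\<^sup>2) + ((K u1 x - y2 x)\<^sup>2 - (K u2 x - y2 x)\<^sup>2)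
        \<le> (K u1 x - K u2 x)\<^sup>2 + (y1 x - y2 x)\<^sup>2"
      by (simp add: power2_eq_square algebra_simps)
  qed (use int int' u y in auto)
  then have cross: "((nY (\<lambda>x. K u2 x - y1 x))\<^sup>2 - (nY (\<lambda>x. K u1 x - y1 x))\<^sup>2)
      + ((nY (\<lambda>x. K u1 x - y2 x))\<^sup>2 - (nY (\<lambda>x. K u2 x - y2 x))\<^sup>2)
      \<le> (nY (\<lambda>x. K u1 x - K u2 x))\<^sup>2 + (nY (\<lambda>x. y1 x - y2 x))\<^sup>2"
    using int int' u y by (simp add: L2_norm_sq)
  have Kw: "nY (K ?w) = nY (\<lambda>x. K u1 x - K u2 x)"
    using K_diff[OF u] by (intro L2_norm_cong_AE K_in L2_space_diff w Ku)
  have "1/2 * energy ?w \<le> (J y1 u2 - J y1 u1) + (J y2 u1 - J y2 u2)"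
    using minimizer_energy_bound[OF y(1) min(1) u(2)] minimizer_energy_bound[OF y(2) min(2) u(1)]
    by (simp add: energy_sym)
  also have "\<dots> \<le> 1/2 * (nY (K ?w))\<^sup>2 + 1/2 * (nY (\<lambda>x. y1 x - y2 x))\<^sup>2"
    using cross unfolding tikhonov_def Kw by linarith
  finally have "\<alpha> * (nV ?w)\<^sup>2 \<le> (nY (\<lambda>x. y1 x - y2 x))\<^sup>2"
    by (simp add: energy_def)
  also have "\<alpha> * (nV ?w)\<^sup>2 = (sqrt \<alpha> * nV ?w)\<^sup>2"
    using \<alpha> by (simp add: power_mult_distrib)
  finally have "sqrt \<alpha> * nV ?w \<le> nY (\<lambda>x. y1 x - y2 x)"
    by (rule power2_le_imp_le) (rule L2_norm_nonneg)
  then show ?thesis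
    using \<alpha> by (simp add: field_simps)
qed

end

section \<open>Bounded Lipschitz domains and the Lipschitz estimate for the solution
  operator\<close>

lemma tikhonov_problemI:
  assumes "bounded_lipschitz_domain N \<Omega>" "0 < s" "s < 1" "0 < \<alpha>" "bounded_linear_H0s_L2 N s \<Omega> K"
  shows "tikhonov_problem N \<Omega> s \<alpha> K"
proof
  \<comment> \<open>Openness gives measurability, and boundedness gives finite measure.\<close>
  show \<Omega>: "\<Omega> \<in> sets (eucl_measure N)"
    using assms(1) by (intro openin_eucl_measurable) (simp add: bounded_lipschitz_domain_def)
  show "emeasure (eucl_measure N) \<Omega> < \<infinity>"
    using assms(1) emeasure_bounded_finite[OF _ \<Omega>] by (auto simp: bounded_lipschitz_domain_def)
qed (use assms in auto)

text \<open>Quantifying \<open>C\<close> before \<open>N\<close>, \<open>\<Omega>\<close>,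
  \<open>s\<close> and \<open>K\<close> expresses that it depends on \<alpha> and the operator norm
  only. The witness is the constant of \<open>minimizer_lipschitz\<close>.\<close>

theorem theorem2p4:
  "\<exists>C :: real \<Rightarrow> real \<Rightarrow> real.
     \<forall>(N :: nat) (\<Omega> :: point set) (s :: real) (\<alpha> :: real) (K :: (point \<Rightarrow> real) \<Rightarrow> (point \<Rightarrow> real)).
       1 \<le> N \<longrightarrow> bounded_lipschitz_domain N \<Omega> \<longrightarrow> 0 < s \<longrightarrow> s < 1 \<longrightarrow> 0 < \<alpha> \<longrightarrow>
       bounded_linear_H0s_L2 N s \<Omega> K \<longrightarrow>
       0 < C \<alpha> (op_norm_H0s_L2 N s \<Omega> K) \<and>
       (\<forall>y1 \<in> L2_space (meas_on N \<Omega>). \<forall>y2 \<in> L2_space (meas_on N \<Omega>). \<forall>u1 u2.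
          is_minimizer N s \<Omega> K \<alpha> y1 u1 \<longrightarrow> is_minimizer N s \<Omega> K \<alpha> y2 u2 \<longrightarrow>
          H0s_norm N s \<Omega> (\<lambda>x. u1 x - u2 x)
            \<le> C \<alpha> (op_norm_H0s_L2 N s \<Omega> K) * L2_norm (meas_on N \<Omega>) (\<lambda>x. y1 x - y2 x)) \<and>
       solution_op N s \<Omega> K \<alpha> \<in> L2_space (meas_on N \<Omega>) \<rightarrow> H0s_space N s \<Omega> \<and>
       (\<exists>L \<ge> 0. \<forall>y1 \<in> L2_space (meas_on N \<Omega>). \<forall>y2 \<in> L2_space (meas_on N \<Omega>).
          H0s_norm N s \<Omega> (\<lambda>x. solution_op N s \<Omega> K \<alpha> y1 x - solution_op N s \<Omega> K \<alpha> y2 x)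
            \<le> L * L2_norm (meas_on N \<Omega>) (\<lambda>x. y1 x - y2 x))"
proof (intro exI[of _ "\<lambda>\<alpha> _. 1 / sqrt \<alpha>"] allI impI)
  fix N :: nat and \<Omega> :: "point set" and s \<alpha> :: real and K :: "(point \<Rightarrow> real) \<Rightarrow> (point \<Rightarrow> real)"
  assume *: "bounded_lipschitz_domain N \<Omega>" "0 < s" "s < 1" "0 < \<alpha>" "bounded_linear_H0s_L2 N s \<Omega> K"
  interpret tikhonov_problem N \<Omega> s \<alpha> K
    using * by (rule tikhonov_problemI)
  \<comment> \<open>\<open>solution_op\<close> is a Hilbert choice, so it yields a minimizer only
    once existence is known.\<close>
  have sol: "is_minimizer N s \<Omega> K \<alpha> y (solution_op N s \<Omega> K \<alpha> y)" if "y \<in> Y" for y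
    using someI_ex[OF minimizer_exists[OF that]]
    by (simp add: is_minimizer_def solution_op_def arg_min_def)
  have "\<exists>L \<ge> 0. \<forall>y1 \<in> Y. \<forall>y2 \<in> Y.
      nV (\<lambda>x. solution_op N s \<Omega> K \<alpha> y1 x - solution_op N s \<Omega> K \<alpha> y2 x) \<le> L * nY (\<lambda>x. y1 x - y2 x)"
    using minimizer_lipschitz sol \<open>0 < \<alpha>\<close> by (intro exI[of _ "1 / sqrt \<alpha>"]) auto
  moreover have "solution_op N s \<Omega> K \<alpha> \<in> Y \<rightarrow> V"
    using sol by (auto simp: is_minimizer_def is_arg_min_def)
  ultimately show "0 < 1 / sqrt \<alpha> \<and>
      (\<forall>y1 \<in> Y. \<forall>y2 \<in> Y. \<forall>u1 u2.
        is_minimizer N s \<Omega> K \<alpha> y1 u1 \<longrightarrow> is_minimizer N s \<Omega> K \<alpha> y2 u2 \<longrightarrow>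
        nV (\<lambda>x. u1 x - u2 x) \<le> 1 / sqrt \<alpha> * nY (\<lambda>x. y1 x - y2 x)) \<and>
      solution_op N s \<Omega> K \<alpha> \<in> Y \<rightarrow> V \<and>
      (\<exists>L \<ge> 0. \<forall>y1 \<in> Y. \<forall>y2 \<in> Y.
        nV (\<lambda>x. solution_op N s \<Omega> K \<alpha> y1 x - solution_op N s \<Omega> K \<alpha> y2 x) \<le> L * nY (\<lambda>x. y1 x - y2 x))"
    using minimizer_lipschitz \<open>0 < \<alpha>\<close> by auto
qed

end
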